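(* $$\int_0^1\int_0^1 \frac{\ln(1+xy)}{(1+x)(1+y)}\,dx\,dy = \sum_{n=1}^{\infty}\frac{(-1)^{n-1}}{n}\left(\sum_{k=1}^{\infty}\frac{(-1)^{k-1}}{n+k}\right)^2 = \frac{\pi^2}{12}\ln 2 + \frac{1}{3}(\ln 2)^3 - \frac{1}{2}\zeta(3).$$
   Context: $\zeta(3)=\sum_{n=1}^\infty \frac{1}{n^3}$ is the value of the Riemann zeta function at $3$. Infinite series are understood as limits of their partial sums. *)

theory Defs
  imports "HOL-Analysis.Analysis"
begin

definition zeta3 :: real where
  "zeta3 = (\<Sum>n. 1 / real (Suc n) ^ 3)"

end

theory Submission
  imports Defs "HOL-Real_Asymp.Real_Asymp"
begin

text \<open>
  Write \<open>L = ln 2\<close>.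

  For the series, the moments \<open>A m\<close> of \<open>1 / (1 + x)\<close> over the unit interval are the alternating tails
  (\<open>alternating_tail_sums_integral\<close>), and the logarithmic series in \<open>x * y\<close> may be integrated termwise
  because its remainder after \<open>N\<close> terms is at most \<open>1 / (N + 1)\<close> on the whole unit square
  (\<open>double_integral_sums\<close>).

  For the closed form, let \<open>g y\<close> be the integral of \<open>ln (1 + x * y) / (1 + x)\<close> over \<open>x\<close>.
  Differentiating under the integral and splitting into partial fractions gives
  \<open>g' y = (ln (1 + y) / y - L) / (1 - y)\<close>. Integration by parts in \<open>y\<close>, with
  \<open>g 1 = L\<^sup>2 / 2\<close>, turns the double integral into \<open>L ^ 3 / 2 - B - J\<close>, where \<open>B\<close> is the integral of
  \<open>(ln (1 + y))\<^sup>2 / y\<close> and \<open>J\<close> that of \<open>ln (1 + y) * (ln (1 + y) - L) / (1 - y)\<close>.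
  The involution \<open>y = (1 - u) / (1 + u)\<close> gives \<open>J = B - L * pi\<^sup>2 / 12 + L ^ 3 / 6\<close>
  (\<open>has_integral_symmetric_part\<close>).

  What remains is \<open>B = zeta3 / 4\<close> (\<open>has_integral_ln_times_ln_quotient\<close>). The parallelogram identity for
  \<open>ln (1 - u)\<close> and \<open>ln (1 + u)\<close> expresses \<open>B\<close> by the integrals of the squares of \<open>ln (1 - u)\<close>,
  \<open>ln (1 - u\<^sup>2)\<close> and \<open>ln ((1 - u) / (1 + u))\<close> divided by \<open>u\<close>. Substitutions reduce these to the
  integrals of \<open>(ln t)\<^sup>2 / (1 - t)\<close> and \<open>(ln t)\<^sup>2 / (1 - t\<^sup>2)\<close>, and the geometric series evaluates the
  latter as \<open>2 * zeta3\<close> and \<open>7 / 4 * zeta3\<close>.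
\<close>

section \<open>Termwise integration and the series\<close>

text \<open>
  The alternating series are integrated termwise by this lemma. The remainder is measured by the
  integral of its bound rather than by its supremum, because the geometric remainder
  has modulus \<open>x ^ N / (1 + x)\<close>, which does not tend to \<open>0\<close> at \<open>x = 1\<close> although its integral does.
\<close>

lemma sums_integral_of_remainder_bound:
  fixes f d :: "nat \<Rightarrow> real \<Rightarrow> real"
  assumes g: "g integrable_on {a..b}"
    and f: "\<And>n. (f n has_integral c n) {a..b}"
    and d: "\<And>N. (d N has_integral e N) {a..b}"
    and bound: "\<And>N x. x \<in> {a..b} \<Longrightarrow> \<bar>g x - (\<Sum>n<N. f n x)\<bar> \<le> d N x"
    and e: "e \<longlonglongrightarrow> 0"
  shows "c sums integral {a..b} g"
proof -
  have "\<bar>integral {a..b} g - (\<Sum>n<N. c n)\<bar> \<le> e N" for N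
  proof -
    have i: "((\<lambda>x. g x - (\<Sum>n<N. f n x)) has_integral (integral {a..b} g - (\<Sum>n<N. c n))) {a..b}"
      by (intro has_integral_diff has_integral_sum f integrable_integral g) auto
    have "norm (integral {a..b} (\<lambda>x. g x - (\<Sum>n<N. f n x))) \<le> integral {a..b} (d N)"
      using i d[of N] bound by (intro integral_norm_bound_integral) (auto simp: has_integral_iff)
    then show ?thesis
      using i d[of N] by (simp add: has_integral_iff)
  qed
  then have "(\<lambda>N. (\<Sum>n<N. c n) - integral {a..b} g) \<longlonglongrightarrow> 0"
    by (intro tendsto_0_le[OF e, where K = 1] always_eventually)
      (auto simp: abs_minus_commute intro: order_trans[OF _ abs_ge_self])
  then show ?thesis
    unfolding sums_def by (rule LIM_zero_cancel)
qed

lemma alternating_geometric_remainder: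
  fixes x :: real
  assumes "1 + x \<noteq> 0"
  shows "1 / (1 + x) - (\<Sum>n<N. (-1) ^ n * x ^ n) = (-1) ^ N * x ^ N / (1 + x)"
proof (induction N)
  case (Suc N)
  have "(-1) ^ N * x ^ N / (1 + x) - (-1) ^ N * x ^ N = (-1) ^ Suc N * x ^ Suc N / (1 + x)"
    using assms by (simp add: field_simps)
  with Suc show ?case
    by simp
qed simp

text \<open>
  The signed remainder \<open>R\<close> has derivative \<open>t ^ N / (1 + t)\<close> by the geometric remainder, and this lies
  between \<open>0\<close> and \<open>t ^ N\<close>; comparing antiderivatives from \<open>0\<close> gives the bound. It stays
  informative at \<open>z = 1\<close>, the endpoint of the disc of convergence.
\<close>

lemma ln_one_plus_remainder_bound:
  fixes z :: real
  assumes "0 \<le> z"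
  shows "\<bar>ln (1 + z) - (\<Sum>n<N. (-1) ^ n / real (Suc n) * z ^ Suc n)\<bar> \<le> z ^ Suc N / real (Suc N)"
proof -
  define R where "R t = (-1) ^ N * (ln (1 + t) - (\<Sum>n<N. (-1) ^ n / real (Suc n) * t ^ Suc n))"
    for t :: real
  have R: "(R has_real_derivative t ^ N / (1 + t)) (at t)" if "0 \<le> t" for t
  proof -
    have p: "((\<lambda>t. (-1) ^ n / real (Suc n) * t ^ Suc n) has_real_derivative (-1) ^ n * t ^ n) (at t)"
      for n
      using DERIV_cmult[OF DERIV_pow[of "Suc n" t], of "(-1) ^ n / real (Suc n)"] by simp
    have "(R has_real_derivative (-1) ^ N * (1 / (1 + t) - (\<Sum>n<N. (-1) ^ n * t ^ n))) (at t)"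
      unfolding R_def using that
      by (intro DERIV_cmult DERIV_diff DERIV_sum p) (auto intro!: derivative_eq_intros)
    also have "(-1) ^ N * (1 / (1 + t) - (\<Sum>n<N. (-1) ^ n * t ^ n)) = t ^ N / (1 + t)"
      using that by (subst alternating_geometric_remainder) (auto simp flip: power_mult_distrib mult.assoc)
    finally show ?thesis .
  qed
  have "R 0 \<le> R z"
    using R by (intro DERIV_nonneg_imp_nondecreasing[OF assms]) force
  moreover have "0 ^ Suc N / real (Suc N) - R 0 \<le> z ^ Suc N / real (Suc N) - R z"
  proof (intro DERIV_nonneg_imp_nondecreasing[OF assms] exI conjI)
    fix t :: real assume t: "0 \<le> t" "t \<le> z"
    show "((\<lambda>t. t ^ Suc N / real (Suc N) - R t) has_real_derivative t ^ N - t ^ N / (1 + t)) (at t)"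
    proof (rule DERIV_diff)
      show "((\<lambda>t. t ^ Suc N / real (Suc N)) has_real_derivative t ^ N) (at t)"
        using DERIV_cdivide[OF DERIV_pow[of "Suc N" t], of "real (Suc N)"] by simp
    qed (use R t in auto)
    show "0 \<le> t ^ N - t ^ N / (1 + t)"
      using t by (simp add: divide_le_eq algebra_simps)
  qed
  moreover have "R 0 = 0"
    by (simp add: R_def)
  ultimately have "\<bar>R z\<bar> \<le> z ^ Suc N / real (Suc N)"
    by simp
  then show ?thesis
    by (simp add: R_def abs_mult power_abs)
qed

lemma has_integral_power_unit:
  "((\<lambda>x::real. x ^ n) has_integral 1 / real (Suc n)) {0..1}"
proof -
  have "((\<lambda>x::real. x ^ n) has_integral 1 ^ Suc n / real (Suc n) - 0 ^ Suc n / real (Suc n)) {0..1}"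
  proof (rule fundamental_theorem_of_calculus)
    show "((\<lambda>x. x ^ Suc n / real (Suc n)) has_vector_derivative x ^ n) (at x within {0..1})" for x :: real
      using DERIV_cdivide[OF DERIV_pow[of "Suc n" x], of "real (Suc n)"]
      by (simp flip: has_real_derivative_iff_has_vector_derivative)
  qed simp
  then show ?thesis by simp
qed

lemma continuous_power_div_one_plus: "continuous_on {0..1} (\<lambda>x::real. x ^ m / (1 + x))"
  by (intro continuous_intros) (auto simp: add_eq_0_iff)

text \<open>
  The inner sum of the series is a moment of \<open>1 / (1 + x)\<close>: expand the geometric series and
  integrate \<open>x ^ (Suc n + k)\<close>.
\<close>

lemma alternating_tail_sums_integral:
  "(\<lambda>k. (-1) ^ k / (real (Suc n) + real (Suc k))) sums integral {0..1} (\<lambda>x. x ^ Suc n / (1 + x))"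
proof (rule sums_integral_of_remainder_bound)
  show "(\<lambda>x::real. x ^ Suc n / (1 + x)) integrable_on {0..1}"
    by (intro integrable_continuous_real continuous_power_div_one_plus)
  show "((\<lambda>x::real. (-1) ^ k * x ^ (Suc n + k)) has_integral (-1) ^ k / (real (Suc n) + real (Suc k))) {0..1}" for k
    using has_integral_mult_right[OF has_integral_power_unit[of "Suc n + k"], of "(-1) ^ k"]
    by (simp add: algebra_simps)
  show "((\<lambda>x::real. x ^ (Suc n + N)) has_integral 1 / real (Suc (Suc n + N))) {0..1}" for N
    by (rule has_integral_power_unit)
  show "(\<lambda>N. 1 / real (Suc (Suc n + N))) \<longlonglongrightarrow> 0"
    by (rule LIMSEQ_subseq_LIMSEQ[OF lim_1_over_n, unfolded o_def]) (auto simp: strict_mono_def)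
  fix N and x :: real assume x: "x \<in> {0..1}"
  have "x ^ Suc n / (1 + x) - (\<Sum>k<N. (-1) ^ k * x ^ (Suc n + k))
      = x ^ Suc n * (1 / (1 + x) - (\<Sum>k<N. (-1) ^ k * x ^ k))"
    by (simp add: right_diff_distrib sum_distrib_left power_add mult_ac)
  also have "\<dots> = (-1) ^ N * (x ^ (Suc n + N) / (1 + x))"
    using x by (subst alternating_geometric_remainder) (auto simp: power_add)
  also have "\<bar>\<dots>\<bar> = x ^ (Suc n + N) / (1 + x)"
    using x by (simp add: abs_mult power_abs)
  also have "\<dots> \<le> x ^ (Suc n + N)"
    using x by (simp add: divide_le_eq distrib_left del: power_Suc)
  finally show "\<bar>x ^ Suc n / (1 + x) - (\<Sum>k<N. (-1) ^ k * x ^ (Suc n + k))\<bar> \<le> x ^ (Suc n + N)" .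
qed

lemma tendsto_inverse_Suc: "(\<lambda>N. 1 / real (Suc N)) \<longlonglongrightarrow> 0"
  by (rule LIMSEQ_Suc[OF lim_1_over_n])

lemma one_plus_mult_pos:
  fixes x y :: real
  assumes "x \<in> {0..1}" "y \<in> {0..1}"
  shows "0 < 1 + x * y"
  using assms by (simp add: add_pos_nonneg)

lemma continuous_integrand_x:
  fixes y :: real
  assumes "y \<in> {0..1}"
  shows "continuous_on {0..1} (\<lambda>x::real. ln (1 + x * y) / ((1 + x) * (1 + y)))"
proof -
  have "1 + x * y \<noteq> 0" if "x \<in> {0..1}" for x :: real
    using one_plus_mult_pos[OF that assms] by simp
  then show ?thesis
    using assms by (intro continuous_intros) (auto simp: add_eq_0_iff)
qed

text \<open>
  Each term of the logarithmic series is a product \<open>(x * y) ^ Suc n\<close>, so its double integral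
  against \<open>1 / ((1 + x) * (1 + y))\<close> factorises into the square of one moment.
\<close>

lemma double_integral_sums:
  defines "A \<equiv> \<lambda>m. integral {0..1} (\<lambda>x::real. x ^ m / (1 + x))"
  assumes int: "(\<lambda>y::real. integral {0..1} (\<lambda>x::real. ln (1 + x * y) / ((1 + x) * (1 + y)))) integrable_on {0..1}"
  shows "(\<lambda>n. (-1) ^ n / real (Suc n) * (A (Suc n))\<^sup>2) sums
    integral {0..1} (\<lambda>y::real. integral {0..1} (\<lambda>x::real. ln (1 + x * y) / ((1 + x) * (1 + y))))"
proof (rule sums_integral_of_remainder_bound[OF int])
  have A: "((\<lambda>x::real. x ^ m / (1 + x)) has_integral A m) {0..1}" for m
    unfolding A_def by (intro integrable_integral integrable_continuous_real continuous_power_div_one_plus)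
  show "((\<lambda>y. (-1) ^ n / real (Suc n) * A (Suc n) * (y ^ Suc n / (1 + y))) has_integral
      (-1) ^ n / real (Suc n) * (A (Suc n))\<^sup>2) {0..1}" for n
    using has_integral_mult_right[OF A[of "Suc n"], of "(-1) ^ n / real (Suc n) * A (Suc n)"]
    by (simp add: power2_eq_square mult_ac)
  show "((\<lambda>y::real. 1 / real (Suc N)) has_integral 1 / real (Suc N)) {0..1}" for N
    using has_integral_const_real[of "1 / real (Suc N)" 0 1] by simp
  show "(\<lambda>N. 1 / real (Suc N)) \<longlonglongrightarrow> 0"
    by (rule tendsto_inverse_Suc)
  fix N and y :: real assume y: "y \<in> {0..1}"
  let ?f = "\<lambda>x::real. ln (1 + x * y) / ((1 + x) * (1 + y))"
  let ?t = "\<lambda>n x. (-1) ^ n / real (Suc n) * (y ^ Suc n / (1 + y)) * (x ^ Suc n / (1 + x))"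
  let ?s = "\<Sum>n<N. (-1) ^ n / real (Suc n) * A (Suc n) * (y ^ Suc n / (1 + y))"
  have f: "?f integrable_on {0..1}"
    using y by (intro integrable_continuous_real continuous_integrand_x)
  have "((\<lambda>x. \<Sum>n<N. ?t n x) has_integral
      (\<Sum>n<N. (-1) ^ n / real (Suc n) * (y ^ Suc n / (1 + y)) * A (Suc n))) {0..1}"
    by (intro has_integral_sum has_integral_mult_right A) auto
  then have s: "((\<lambda>x. \<Sum>n<N. ?t n x) has_integral ?s) {0..1}"
    by (simp add: mult_ac)
  have "\<bar>?f x - (\<Sum>n<N. ?t n x)\<bar> \<le> 1 / real (Suc N)" if x: "x \<in> {0..1}" for x
  proof -
    have z: "0 \<le> x * y" "x * y \<le> 1"
      using x y by (auto simp: mult_le_one)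
    have "?f x - (\<Sum>n<N. ?t n x)
        = (ln (1 + x * y) - (\<Sum>n<N. (-1) ^ n / real (Suc n) * (x * y) ^ Suc n)) / ((1 + x) * (1 + y))"
      by (simp add: diff_divide_distrib sum_divide_distrib power_mult_distrib mult_ac)
    then have "\<bar>?f x - (\<Sum>n<N. ?t n x)\<bar>
        = \<bar>ln (1 + x * y) - (\<Sum>n<N. (-1) ^ n / real (Suc n) * (x * y) ^ Suc n)\<bar> / ((1 + x) * (1 + y))"
      using x y by (simp add: abs_mult)
    also have "\<dots> \<le> \<bar>ln (1 + x * y) - (\<Sum>n<N. (-1) ^ n / real (Suc n) * (x * y) ^ Suc n)\<bar> / 1"
    proof (rule divide_left_mono)
      show "1 \<le> (1 + x) * (1 + y)"
        using x y z by (simp add: algebra_simps)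
    qed (use x y in auto)
    also have "\<dots> \<le> (x * y) ^ Suc N / real (Suc N)"
      using ln_one_plus_remainder_bound[OF z(1), of N] by simp
    also have "\<dots> \<le> 1 / real (Suc N)"
      using z by (intro divide_right_mono power_le_one) auto
    finally show ?thesis .
  qed
  then have "norm (integral {0..1} (\<lambda>x. ?f x - (\<Sum>n<N. ?t n x))) \<le> integral {0..1} (\<lambda>x::real. 1 / real (Suc N))"
    using f s by (intro integral_norm_bound_integral integrable_diff) (auto simp: has_integral_iff)
  moreover have "integral {0..1} (\<lambda>x. ?f x - (\<Sum>n<N. ?t n x)) = integral {0..1} ?f - ?s"
    using f s by (simp add: integral_diff has_integral_iff)
  ultimately show "\<bar>integral {0..1} ?f - ?s\<bar> \<le> 1 / real (Suc N)"
    by simp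
qed

section \<open>Zeta sums and logarithmic power integrals\<close>

lemma zeta3_sums: "(\<lambda>n. 1 / real (Suc n) ^ 3) sums zeta3"
  unfolding zeta3_def
proof (rule summable_sums)
  have "summable (\<lambda>n. inverse (real n ^ 3))"
    by (rule inverse_power_summable) simp
  then have "summable (\<lambda>n. inverse (real (Suc n) ^ 3))"
    by (subst summable_Suc_iff)
  then show "summable (\<lambda>n. 1 / real (Suc n) ^ 3)"
    by (simp only: inverse_eq_divide)
qed

text \<open>
  The even denominators contribute \<open>1 / 2 ^ s\<close> times the whole sum.
\<close>

lemma odd_part_sums:
  fixes c :: real
  assumes "(\<lambda>n. 1 / real (Suc n) ^ s) sums c"
  shows "(\<lambda>n. if even n then 1 / real (Suc n) ^ s else 0) sums ((1 - 1 / 2 ^ s) * c)"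
proof -
  have "(\<lambda>n. if odd n then 1 / real (Suc n) ^ s else 0) sums (c / 2 ^ s)"
  proof (subst sums_mono_reindex[where g = "\<lambda>n. Suc (2 * n)", symmetric])
    have "1 / real (Suc (Suc (2 * n))) ^ s = 1 / real (Suc n) ^ s / 2 ^ s" for n
    proof -
      have "real (Suc (Suc (2 * n))) = real (Suc n) * 2"
        by simp
      then show ?thesis
        by (simp only: power_mult_distrib divide_divide_eq_left)
    qed
    then show "(\<lambda>n. if odd (Suc (2 * n)) then 1 / real (Suc (Suc (2 * n))) ^ s else 0) sums (c / 2 ^ s)"
      using sums_divide[OF assms, of "2 ^ s"] by simp
    fix n assume "n \<notin> range (\<lambda>n. Suc (2 * n))"
    then show "(if odd n then 1 / real (Suc n) ^ s else 0) = 0"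
      by (metis Suc_eq_plus1 oddE rangeI)
  qed (auto simp: strict_mono_def)
  \<comment> \<open>Odd index \<open>n\<close> means even denominator \<open>Suc n\<close>.\<close>
  from sums_diff[OF assms this] show ?thesis
    by (rule iffD1[OF arg_cong2[where f = "(sums)"], rotated 2]) (auto simp: algebra_simps)
qed

lemma odd_reindex_sums:
  fixes c :: real
  assumes "(\<lambda>n. 1 / real (Suc n) ^ s) sums c"
  shows "(\<lambda>n. 1 / real (Suc (2 * n)) ^ s) sums ((1 - 1 / 2 ^ s) * c)"
proof -
  have "(\<lambda>n. if even (2 * n) then 1 / real (Suc (2 * n)) ^ s else 0) sums ((1 - 1 / 2 ^ s) * c)"
    using odd_part_sums[OF assms]
    by (subst sums_mono_reindex[where g = "\<lambda>n. 2 * n"]) (auto simp: strict_mono_def)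
  then show ?thesis by simp
qed

lemma alternating_inverse_squares_sums: "(\<lambda>n. (-1) ^ n / (real (Suc n))\<^sup>2) sums (pi\<^sup>2 / 12)"
proof -
  have z: "(\<lambda>n. 1 / real (Suc n) ^ 2) sums (pi\<^sup>2 / 6)"
    using inverse_squares_sums by (simp add: add.commute)
  have "(\<lambda>n. (if even n then 1 / real (Suc n) ^ 2 else 0) * 2 - 1 / real (Suc n) ^ 2) sums
      ((1 - 1 / 2 ^ 2) * (pi\<^sup>2 / 6) * 2 - pi\<^sup>2 / 6)"
    by (intro sums_diff sums_mult2 odd_part_sums z)
  moreover have "(if even n then 1 / real (Suc n) ^ 2 else 0) * 2 - 1 / real (Suc n) ^ 2
      = (-1) ^ n / (real (Suc n))\<^sup>2" for n
    by auto
  ultimately show ?thesis by simp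
qed

text \<open>
  Integrating by parts twice gives the antiderivative \<open>F\<close>. Its factors \<open>t * ln t\<close> and
  \<open>t * (ln t)\<^sup>2\<close> are kept apart because they are continuous at \<open>0\<close>, with the value \<open>0\<close> that the
  convention \<open>ln 0 = 0\<close> assigns to them.
\<close>

lemma has_integral_power_ln_squared:
  "((\<lambda>t::real. t ^ n * (ln t)\<^sup>2) has_integral 2 / real (Suc n) ^ 3) {0..1}"
proof -
  define m where "m = real (Suc n)"
  have m: "m > 0" by (simp add: m_def)
  define u1 u2 where "u1 t = t * ln t" and "u2 t = t * (ln t)\<^sup>2" for t :: real
  define F where "F t = t ^ n * u2 t / m - 2 * t ^ n * u1 t / m\<^sup>2 + 2 * t ^ Suc n / m ^ 3" for t :: real
  have "((\<lambda>t::real. t ^ n * (ln t)\<^sup>2) has_integral (F 1 - F 0)) {0..1}"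
  proof (rule fundamental_theorem_of_calculus_interior)
    have at0: "at (0::real) within {0..1} = at_right 0"
      by (simp add: at_within_Icc_at_right)
    have c1: "continuous_on {0..1} u1"
      unfolding continuous_on_eq_continuous_within
    proof
      fix t :: real assume "t \<in> {0..1}"
      have "((\<lambda>t::real. t * ln t) \<longlongrightarrow> 0) (at_right 0)"
        by real_asymp
      then show "continuous (at t within {0..1}) u1"
        by (cases "t = 0") (auto simp: u1_def[abs_def] continuous_within at0 intro!: tendsto_intros)
    qed
    have c2: "continuous_on {0..1} u2"
      unfolding continuous_on_eq_continuous_within
    proof
      fix t :: real assume "t \<in> {0..1}"
      have "((\<lambda>t::real. t * (ln t)\<^sup>2) \<longlongrightarrow> 0) (at_right 0)"
        by real_asymp
      then show "continuous (at t within {0..1}) u2"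
        by (cases "t = 0") (auto simp: u2_def[abs_def] continuous_within at0 intro!: tendsto_intros)
    qed
    show "continuous_on {0..1} F"
      unfolding F_def using m by (intro continuous_intros c1 c2) auto
    fix t :: real assume t: "t \<in> {0<..<1}"
    have "(F has_real_derivative t ^ n * (ln t)\<^sup>2) (at t)"
    proof -
      have P: "((\<lambda>t. t ^ Suc n) has_real_derivative m * t ^ n) (at t)"
        using DERIV_pow[of "Suc n" t] by (simp add: m_def)
      have L: "(ln has_real_derivative 1 / t) (at t)"
        using t by (auto intro!: derivative_eq_intros)
      have "((\<lambda>t. (ln t)\<^sup>2) has_real_derivative 2 * ln t * (1 / t)) (at t)"
        using DERIV_power[OF L, of 2] by simp
      from DERIV_mult[OF P this]
      have D2: "((\<lambda>t. t ^ Suc n * (ln t)\<^sup>2) has_real_derivative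
          m * t ^ n * (ln t)\<^sup>2 + t ^ Suc n * (2 * ln t * (1 / t))) (at t)"
        by (simp add: mult_ac)
      have D1: "((\<lambda>t. 2 * t ^ Suc n * ln t) has_real_derivative
          2 * (m * t ^ n) * ln t + 2 * t ^ Suc n * (1 / t)) (at t)"
        using DERIV_mult[OF DERIV_cmult[OF P, of 2] L] by (simp add: mult_ac)
      have "((\<lambda>t. t ^ Suc n * (ln t)\<^sup>2 / m - 2 * t ^ Suc n * ln t / m\<^sup>2 + 2 * t ^ Suc n / m ^ 3)
        has_real_derivative (m * t ^ n * (ln t)\<^sup>2 + t ^ Suc n * (2 * ln t * (1 / t))) / m
          - (2 * (m * t ^ n) * ln t + 2 * t ^ Suc n * (1 / t)) / m\<^sup>2 + 2 * (m * t ^ n) / m ^ 3) (at t)"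
        by (intro DERIV_add DERIV_diff DERIV_cdivide D1 D2 DERIV_cmult P)
      also have "(m * t ^ n * (ln t)\<^sup>2 + t ^ Suc n * (2 * ln t * (1 / t))) / m 
          - (2 * (m * t ^ n) * ln t + 2 * t ^ Suc n * (1 / t)) / m\<^sup>2 + 2 * (m * t ^ n) / m ^ 3 = t ^ n * (ln t)\<^sup>2"
        using t m by (simp add: field_simps power2_eq_square power3_eq_cube)
      finally show ?thesis
        by (simp add: F_def[abs_def] u1_def u2_def mult_ac)
    qed
    then show "(F has_vector_derivative t ^ n * (ln t)\<^sup>2) (at t)"
      by (simp add: has_real_derivative_iff_has_vector_derivative)
  qed simp
  moreover have "F 1 - F 0 = 2 / real (Suc n) ^ 3"
    by (simp add: F_def u1_def u2_def m_def)
  ultimately show ?thesis by simp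
qed

text \<open>
  Integrals of \<open>g t * (ln t)\<^sup>2\<close>, where \<open>g\<close> is a power series, are evaluated as nonnegative Lebesgue
  integrals, so that monotone convergence exchanges sum and integral and the singularities at both
  ends need no separate treatment. The endpoints are harmless also pointwise, since
  \<open>ln 0 = ln 1 = 0\<close>.
\<close>

lemma nn_integral_ln_squared_series:
  fixes p :: "nat \<Rightarrow> nat"
  assumes g: "\<And>t. t \<in> {0<..<1} \<Longrightarrow> (\<lambda>n. t ^ p n) sums g t"
    and c: "(\<lambda>n. 2 / real (Suc (p n)) ^ 3) sums c"
  shows "(\<integral>\<^sup>+t. ennreal (g t * (ln t)\<^sup>2) * indicator {0..1} t \<partial>lborel) = ennreal c"
proof -
  have "(\<integral>\<^sup>+t. ennreal (g t * (ln t)\<^sup>2) * indicator {0..1} t \<partial>lborel)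
      = (\<integral>\<^sup>+t. (\<Sum>n. ennreal (t ^ p n * (ln t)\<^sup>2) * indicator {0..1} t) \<partial>lborel)"
  proof (rule nn_integral_cong)
    fix t :: real
    have "ennreal (g t * (ln t)\<^sup>2) = (\<Sum>n. ennreal (t ^ p n * (ln t)\<^sup>2))" if "t \<in> {0..1}"
    proof (cases "t \<in> {0<..<1}")
      case True
      have S: "(\<lambda>n. t ^ p n * (ln t)\<^sup>2) sums (g t * (ln t)\<^sup>2)"
        by (intro sums_mult2 g True)
      have "0 \<le> g t * (ln t)\<^sup>2"
        by (rule sums_le[OF _ sums_zero S]) (use True in simp)
      then show ?thesis
        using True S by (intro sums_unique) (subst sums_ennreal, auto)
    next
      case False
      then have "ln t = 0" using that by auto
      then show ?thesis by simp
    qed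
    then show "ennreal (g t * (ln t)\<^sup>2) * indicator {0..1} t = (\<Sum>n. ennreal (t ^ p n * (ln t)\<^sup>2) * indicator {0..1} t)"
      by (auto simp: indicator_def)
  qed
  also have "\<dots> = (\<Sum>n. \<integral>\<^sup>+t. ennreal (t ^ p n * (ln t)\<^sup>2) * indicator {0..1} t \<partial>lborel)"
    by (rule nn_integral_suminf) measurable
  also have "\<dots> = (\<Sum>n. ennreal (2 / real (Suc (p n)) ^ 3))"
    by (intro suminf_cong nn_integral_has_integral_lebesgue' has_integral_power_ln_squared) auto
  also have "\<dots> = ennreal c"
    using c by (intro sums_unique[symmetric]) (subst sums_ennreal, auto simp: sums_iff intro!: suminf_nonneg simp del: of_nat_Suc)
  finally show ?thesis .
qed

lemma nn_integral_ln_squared_div_one_minus: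
  "(\<integral>\<^sup>+t. ennreal ((ln t)\<^sup>2 / (1 - t)) * indicator {0..1} t \<partial>lborel) = ennreal (2 * zeta3)"
  using nn_integral_ln_squared_series[where p = "\<lambda>n. n" and g = "\<lambda>t. 1 / (1 - t)"]
    geometric_sums[where 'a = real] sums_mult[OF zeta3_sums, of 2] by simp

lemma nn_integral_ln_squared_div_one_minus_square:
  "(\<integral>\<^sup>+t. ennreal ((ln t)\<^sup>2 / (1 - t\<^sup>2)) * indicator {0..1} t \<partial>lborel) = ennreal (7 / 4 * zeta3)"
proof -
  have "(\<lambda>n. t ^ (2 * n)) sums (1 / (1 - t\<^sup>2))" if "t \<in> {0<..<1}" for t :: real
    using geometric_sums[of "t\<^sup>2"] that by (simp add: power_mult power_less_one_iff abs_square_less_1)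
  moreover have "(\<lambda>n. 2 / real (Suc (2 * n)) ^ 3) sums (7 / 4 * zeta3)"
    using sums_mult[OF odd_reindex_sums[OF zeta3_sums], of 2] by simp
  ultimately show ?thesis
    using nn_integral_ln_squared_series[where p = "\<lambda>n. 2 * n" and g = "\<lambda>t. 1 / (1 - t\<^sup>2)"] by simp
qed

section \<open>Two logarithmic integrals\<close>

text \<open>
  The continuous extension of \<open>ln (1 + u) / u\<close> to \<open>u = 0\<close>. Fundamental theorem and substitution
  can then be applied on the closed interval.
\<close>

definition ln_quotient :: "real \<Rightarrow> real" where
  "ln_quotient u = (if u = 0 then 1 else ln (1 + u) / u)"

lemma continuous_ln_quotient: "continuous_on {0..1} ln_quotient"
  unfolding continuous_on_eq_continuous_within
proof
  fix u :: real assume u: "u \<in> {0..1}"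
  show "continuous (at u within {0..1}) ln_quotient"
  proof (cases "u = 0")
    case True
    have "((\<lambda>u::real. ln (1 + u) / u) \<longlongrightarrow> 1) (at_right 0)"
      by real_asymp
    then have "(ln_quotient \<longlongrightarrow> 1) (at_right 0)"
      by (rule Lim_transform_eventually) (auto simp: ln_quotient_def eventually_at_filter)
    then show ?thesis
      using True by (simp add: continuous_within at_within_Icc_at_right) (simp add: ln_quotient_def)
  next
    case False
    have "((\<lambda>u. ln (1 + u) / u) \<longlongrightarrow> ln (1 + u) / u) (at u within {0..1})"
      using u False by (intro tendsto_intros) auto
    then have "(ln_quotient \<longlongrightarrow> ln (1 + u) / u) (at u within {0..1})"
    proof (rule Lim_transform_eventually)
      have "eventually (\<lambda>v. v \<noteq> 0) (at u within {0..1})"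
        using False by (intro eventually_neq_at_within)
      then show "eventually (\<lambda>v. ln (1 + v) / v = ln_quotient v) (at u within {0..1})"
        by eventually_elim (simp add: ln_quotient_def)
    qed
    then show ?thesis
      using False by (simp add: continuous_within) (simp add: ln_quotient_def)
  qed
qed

lemma continuous_ln_one_plus: "continuous_on {0..1} (\<lambda>u::real. ln (1 + u))"
  by (intro continuous_intros) (auto simp: add_eq_0_iff)

text \<open>
  The logarithmic series, divided by \<open>u\<close>, integrates to the alternating series of the inverse
  squares.
\<close>

lemma has_integral_ln_quotient: "(ln_quotient has_integral pi\<^sup>2 / 12) {0..1}"
proof -
  have int: "ln_quotient integrable_on {0..1}"
    by (intro integrable_continuous_real continuous_ln_quotient)
  have "(\<lambda>n. (-1) ^ n / (real (Suc n))\<^sup>2) sums integral {0..1} ln_quotient"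
  proof (rule sums_integral_of_remainder_bound[OF int])
    show "((\<lambda>u. (-1) ^ n / real (Suc n) * u ^ n) has_integral (-1) ^ n / (real (Suc n))\<^sup>2) {0..1}" for n
      using has_integral_mult_right[OF has_integral_power_unit[of n], of "(-1) ^ n / real (Suc n)"]
      by (simp add: power2_eq_square)
    show "((\<lambda>u::real. 1 / real (Suc N)) has_integral 1 / real (Suc N)) {0..1}" for N
      using has_integral_const_real[of "1 / real (Suc N)" 0 1] by simp
    show "(\<lambda>N. 1 / real (Suc N)) \<longlonglongrightarrow> 0"
      by (rule tendsto_inverse_Suc)
    fix N and u :: real assume u: "u \<in> {0..1}"
    show "\<bar>ln_quotient u - (\<Sum>n<N. (-1) ^ n / real (Suc n) * u ^ n)\<bar> \<le> 1 / real (Suc N)"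
    proof (cases "u = 0")
      case True
      have "(\<Sum>n<N. (-1) ^ n / real (Suc n) * 0 ^ n) = (if N = 0 then 0 else 1 :: real)"
        by (cases N) (simp_all add: sum.lessThan_Suc_shift del: sum.lessThan_Suc)
      then show ?thesis
        using True by (simp add: ln_quotient_def)
    next
      case False
      with u have u0: "0 < u" "u \<le> 1" by auto
      have "ln_quotient u - (\<Sum>n<N. (-1) ^ n / real (Suc n) * u ^ n)
          = (ln (1 + u) - (\<Sum>n<N. (-1) ^ n / real (Suc n) * u ^ Suc n)) / u"
        using u0 by (simp add: ln_quotient_def diff_divide_distrib sum_divide_distrib)
      also have "\<bar>\<dots>\<bar> = \<bar>ln (1 + u) - (\<Sum>n<N. (-1) ^ n / real (Suc n) * u ^ Suc n)\<bar> / u"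
        using u0 by simp
      also have "\<dots> \<le> (u ^ Suc N / real (Suc N)) / u"
        using u0 by (intro divide_right_mono ln_one_plus_remainder_bound) auto
      also have "\<dots> = u ^ N / real (Suc N)"
        using u0 by simp
      also have "\<dots> \<le> 1 / real (Suc N)"
        using u0 by (intro divide_right_mono power_le_one) auto
      finally show ?thesis .
    qed
  qed
  then have "integral {0..1} ln_quotient = pi\<^sup>2 / 12"
    using alternating_inverse_squares_sums sums_unique2 by blast
  then show ?thesis
    using int by (simp add: has_integral_iff)
qed

lemma nn_integral_substitution_unit:
  fixes f g g' :: "real \<Rightarrow> real"
  assumes [measurable]: "f \<in> borel_measurable borel"
    and "\<And>x. x \<in> {0..1} \<Longrightarrow> (g has_real_derivative g' x) (at x)"
    and "continuous_on {0..1} g'" "\<And>x. x \<in> {0..1} \<Longrightarrow> 0 \<le> g' x" "g 0 = 0" "g 1 = 1"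
  shows "(\<integral>\<^sup>+s. ennreal (f (g s) * g' s) * indicator {0..1} s \<partial>lborel)
    = (\<integral>\<^sup>+x. ennreal (f x) * indicator {0..1} x \<partial>lborel)"
proof -
  have "set_borel_measurable borel {g 0..g 1} f"
    unfolding set_borel_measurable_def by measurable
  from nn_integral_substitution[OF this assms(2-4)] show ?thesis
    using assms by (simp add: nn_integral_set_ennreal)
qed

text \<open>
  The substitution \<open>x = s * (2 - s)\<close>, for which \<open>1 - x = (1 - s)\<^sup>2\<close>, in the integral of
  \<open>(ln x)\<^sup>2 / (1 - x)\<close>.
\<close>

lemma nn_integral_ln_squared_symmetric_product:
  "(\<integral>\<^sup>+s. ennreal (2 * ((ln (s * (2 - s)))\<^sup>2 / (1 - s))) * indicator {0..1} s \<partial>lborel) = ennreal (2 * zeta3)"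
proof -
  let ?f = "\<lambda>x::real. (ln x)\<^sup>2 / (1 - x)"
  let ?g = "\<lambda>s::real. s * (2 - s)"
  have "(\<integral>\<^sup>+s. ennreal (2 * ((ln (s * (2 - s)))\<^sup>2 / (1 - s))) * indicator {0..1} s \<partial>lborel)
      = (\<integral>\<^sup>+s. ennreal (?f (?g s) * (2 - 2 * s)) * indicator {0..1} s \<partial>lborel)"
  proof (rule nn_integral_cong)
    fix s :: real
    have e: "1 - s * (2 - s) = (1 - s) * (1 - s)"
      by (simp add: algebra_simps)
    have "2 * ((ln (s * (2 - s)))\<^sup>2 / (1 - s)) = ?f (?g s) * (2 - 2 * s)"
      unfolding e by (cases "s = 1") (auto simp: divide_simps algebra_simps)
    then show "ennreal (2 * ((ln (s * (2 - s)))\<^sup>2 / (1 - s))) * indicator {0..1} s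
        = ennreal (?f (?g s) * (2 - 2 * s)) * indicator {0..1} s"
      by (simp only:)
  qed
  also have "\<dots> = (\<integral>\<^sup>+x. ennreal (?f x) * indicator {0..1} x \<partial>lborel)"
    by (rule nn_integral_substitution_unit) (auto intro!: derivative_eq_intros continuous_intros)
  also have "\<dots> = ennreal (2 * zeta3)"
    using nn_integral_ln_squared_div_one_minus by simp
  finally show ?thesis .
qed

text \<open>
  The substitution \<open>x = s / (2 - s)\<close>, for which \<open>1 - x\<^sup>2 = 4 * (1 - s) / (2 - s)\<^sup>2\<close>, in the integral of
  \<open>(ln x)\<^sup>2 / (1 - x\<^sup>2)\<close>.
\<close>

lemma nn_integral_ln_squared_symmetric_quotient:
  "(\<integral>\<^sup>+s. ennreal ((ln (s / (2 - s)))\<^sup>2 / (2 * (1 - s))) * indicator {0..1} s \<partial>lborel)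
    = ennreal (7 / 4 * zeta3)"
proof -
  let ?f = "\<lambda>x::real. (ln x)\<^sup>2 / (1 - x\<^sup>2)"
  let ?g = "\<lambda>s::real. s / (2 - s)"
  have "(\<integral>\<^sup>+s. ennreal ((ln (s / (2 - s)))\<^sup>2 / (2 * (1 - s))) * indicator {0..1} s \<partial>lborel)
      = (\<integral>\<^sup>+s. ennreal (?f (?g s) * (2 / (2 - s)\<^sup>2)) * indicator {0..1} s \<partial>lborel)"
  proof (rule nn_integral_cong)
    fix s :: real
    have "(ln (s / (2 - s)))\<^sup>2 / (2 * (1 - s)) = ?f (?g s) * (2 / (2 - s)\<^sup>2)" if "s \<in> {0..1}"
    proof -
      have cancel: "a * 2 / (4 * c) = a / (2 * c)" for a c :: real
        by simp
      have e: "(1 - (s / (2 - s))\<^sup>2) * (2 - s)\<^sup>2 = 4 * (1 - s)"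
        using that by (simp add: left_diff_distrib power_divide) (simp add: power2_eq_square algebra_simps)
      have "?f (?g s) * (2 / (2 - s)\<^sup>2) = (ln (s / (2 - s)))\<^sup>2 * 2 / (4 * (1 - s))"
        by (simp only: times_divide_times_eq e)
      also have "\<dots> = (ln (s / (2 - s)))\<^sup>2 / (2 * (1 - s))"
        by (rule cancel)
      finally show ?thesis ..
    qed
    then show "ennreal ((ln (s / (2 - s)))\<^sup>2 / (2 * (1 - s))) * indicator {0..1} s
        = ennreal (?f (?g s) * (2 / (2 - s)\<^sup>2)) * indicator {0..1} s"
      by (auto simp: indicator_def)
  qed
  also have "\<dots> = (\<integral>\<^sup>+x. ennreal (?f x) * indicator {0..1} x \<partial>lborel)"
  proof (rule nn_integral_substitution_unit)
    show "(?g has_real_derivative 2 / (2 - s)\<^sup>2) (at s)" if "s \<in> {0..1}" for s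
      using that by (auto intro!: derivative_eq_intros simp: power2_eq_square)
  qed (auto intro!: continuous_intros)
  also have "\<dots> = ennreal (7 / 4 * zeta3)"
    using nn_integral_ln_squared_div_one_minus_square by simp
  finally show ?thesis .
qed

text \<open>
  The integral of \<open>(ln (1 + u))\<^sup>2 / u\<close>. Reflected by \<open>u = 1 - s\<close> it becomes the integral of
  \<open>(ln (2 - s))\<^sup>2 / (1 - s)\<close>. With \<open>a = ln s\<close> and \<open>b = ln (2 - s)\<close>, the identity
  \<open>a\<^sup>2 + b\<^sup>2 = (a + b)\<^sup>2 / 2 + (a - b)\<^sup>2 / 2\<close> leaves the integral of \<open>a\<^sup>2 / (1 - s)\<close> and two
  others, where \<open>a + b\<close> and \<open>a - b\<close> are the logarithms treated by the two substitutions above.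
\<close>

lemma has_integral_ln_times_ln_quotient: "((\<lambda>u. ln (1 + u) * ln_quotient u) has_integral zeta3 / 4) {0..1}"
proof -
  let ?k = "\<lambda>u. ln (1 + u) * ln_quotient u"
  define b where "b = integral {0..1} ?k"
  have cont: "continuous_on {0..1} ?k"
    by (intro continuous_on_mult continuous_ln_one_plus continuous_ln_quotient)
  have "((\<lambda>s. -1 *\<^sub>R ?k (1 - s)) has_integral (integral {1 - 0..1 - 1} ?k - integral {1 - 1..1 - 0} ?k)) {0..1}"
    by (rule has_integral_substitution_general[where s = "{}" and c = 0 and d = 1])
      (auto intro!: cont continuous_intros derivative_eq_intros)
  from has_integral_neg[OF this] have "((\<lambda>s. ?k (1 - s)) has_integral b) {0..1}"
    by (simp add: b_def)
  then have B: "((\<lambda>s. (ln (2 - s))\<^sup>2 / (1 - s)) has_integral b) {0..1}"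
    by (rule has_integral_eq[rotated]) (auto simp: ln_quotient_def power2_eq_square)
  then have b: "0 \<le> b"
    by (rule has_integral_nonneg) auto
  have z: "0 \<le> zeta3"
    by (rule sums_le[OF _ sums_zero zeta3_sums]) simp
  have "ennreal (2 * zeta3) + ennreal b
      = (\<integral>\<^sup>+s. ennreal ((ln s)\<^sup>2 / (1 - s)) * indicator {0..1} s
          + ennreal ((ln (2 - s))\<^sup>2 / (1 - s)) * indicator {0..1} s \<partial>lborel)"
    using nn_integral_has_integral_lebesgue'[OF _ B]
    by (subst nn_integral_add) (auto simp: nn_integral_ln_squared_div_one_minus)
  also have "\<dots> = (\<integral>\<^sup>+s. ennreal (1 / 4) * (ennreal (2 * ((ln (s * (2 - s)))\<^sup>2 / (1 - s))) * indicator {0..1} s)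
          + ennreal ((ln (s / (2 - s)))\<^sup>2 / (2 * (1 - s))) * indicator {0..1} s \<partial>lborel)"
  proof (rule nn_integral_cong_AE)
    have pointwise: "ennreal ((ln s)\<^sup>2 / (1 - s)) + ennreal ((ln (2 - s))\<^sup>2 / (1 - s))
        = ennreal (1 / 4) * ennreal (2 * ((ln (s * (2 - s)))\<^sup>2 / (1 - s))) + ennreal ((ln (s / (2 - s)))\<^sup>2 / (2 * (1 - s)))"
      if s: "0 < s" "s \<le> 1" for s :: real
    proof -
      have "(ln s)\<^sup>2 / (1 - s) + (ln (2 - s))\<^sup>2 / (1 - s)
        = 1 / 4 * (2 * ((ln s + ln (2 - s))\<^sup>2 / (1 - s))) + (ln s - ln (2 - s))\<^sup>2 / (2 * (1 - s))"
        by (cases "s = 1") (simp_all add: divide_simps, simp add: power2_eq_square algebra_simps)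
      then have "(ln s)\<^sup>2 / (1 - s) + (ln (2 - s))\<^sup>2 / (1 - s)
        = 1 / 4 * (2 * ((ln (s * (2 - s)))\<^sup>2 / (1 - s))) + (ln (s / (2 - s)))\<^sup>2 / (2 * (1 - s))"
        using s by (simp add: ln_mult ln_div)
      then show ?thesis
        using s by (simp flip: ennreal_plus ennreal_mult)
    qed
    show "AE s in lborel. ennreal ((ln s)\<^sup>2 / (1 - s)) * indicator {0..1} s
          + ennreal ((ln (2 - s))\<^sup>2 / (1 - s)) * indicator {0..1} s
        = ennreal (1 / 4) * (ennreal (2 * ((ln (s * (2 - s)))\<^sup>2 / (1 - s))) * indicator {0..1} s)
          + ennreal ((ln (s / (2 - s)))\<^sup>2 / (2 * (1 - s))) * indicator {0..1} s"
      \<comment> \<open>The factorisations of the logarithms fail at \<open>s = 0\<close>, where \<open>ln 0 = 0\<close>.\<close>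
      using AE_lborel_singleton[of "0::real"] by eventually_elim (auto simp: indicator_def pointwise)
  qed
  also have "\<dots> = ennreal (1 / 4) * ennreal (2 * zeta3) + ennreal (7 / 4 * zeta3)"
    by (subst nn_integral_add, measurable, subst nn_integral_cmult, measurable)
      (simp only: nn_integral_ln_squared_symmetric_product nn_integral_ln_squared_symmetric_quotient)
  also have "\<dots> = ennreal (1 / 4 * (2 * zeta3) + 7 / 4 * zeta3)"
    using z by (subst ennreal_plus, simp, simp, subst ennreal_mult) simp_all
  also have "ennreal (2 * zeta3) + ennreal b = ennreal (2 * zeta3 + b)"
    using z b by (intro ennreal_plus[symmetric]) simp_all
  finally have "2 * zeta3 + b = 1 / 4 * (2 * zeta3) + 7 / 4 * zeta3"
    using z b by (subst (asm) ennreal_inj) simp_all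
  then have "b = zeta3 / 4"
    by simp
  then show ?thesis
    using integrable_continuous_real[OF cont] unfolding b_def by (simp add: has_integral_iff)
qed

section \<open>The double integral in closed form\<close>

lemma has_integral_real_FTC:
  fixes F :: "real \<Rightarrow> real"
  assumes "a \<le> b" "\<And>x. x \<in> {a..b} \<Longrightarrow> (F has_real_derivative f x) (at x within {a..b})"
  shows "(f has_integral F b - F a) {a..b}"
  using assms by (intro fundamental_theorem_of_calculus)
    (auto simp: has_real_derivative_iff_has_vector_derivative)

text \<open>
  The involution \<open>y = (1 - u) / (1 + u)\<close> maps \<open>ln (1 + y)\<close> to \<open>ln 2 - ln (1 + u)\<close> and
  moves the apparent singularity at \<open>y = 1\<close> to \<open>u = 0\<close>, where \<open>ln_quotient\<close> absorbs it. The transformed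
  integrand \<open>p\<close> splits, by \<open>1 / (u * (1 + u)) = 1 / u - 1 / (1 + u)\<close>, into integrals already known
  and an elementary one.
\<close>

lemma has_integral_symmetric_part:
  "((\<lambda>y. ln (1 + y) * (ln (1 + y) - ln 2) / (1 - y)) has_integral
    zeta3 / 4 - ln 2 * (pi\<^sup>2 / 12) + (ln 2) ^ 3 / 6) {0..1::real}"
proof -
  define p :: "real \<Rightarrow> real" where "p u = ln_quotient u * (ln (1 + u) - ln 2) / (1 + u)" for u
  let ?g = "\<lambda>y::real. (1 - y) / (1 + y)"
  have cont: "continuous_on {0..1} p"
    unfolding p_def by (intro continuous_intros continuous_ln_quotient continuous_ln_one_plus) (auto simp: add_eq_0_iff)
  have "((\<lambda>u. ((ln (1 + u))\<^sup>2 - ln 2 * ln (1 + u)) / (1 + u)) has_integral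
      ((ln (1 + 1)) ^ 3 / 3 - ln 2 * (ln (1 + 1))\<^sup>2 / 2) - ((ln (1 + 0)) ^ 3 / 3 - ln 2 * (ln (1 + 0))\<^sup>2 / 2)) {0..1::real}"
    by (rule has_integral_real_FTC)
      (auto intro!: derivative_eq_intros simp: divide_simps, simp add: algebra_simps)
  then have q: "((\<lambda>u. ((ln (1 + u))\<^sup>2 - ln 2 * ln (1 + u)) / (1 + u)) has_integral - ((ln 2) ^ 3 / 6)) {0..1::real}"
    by (simp add: power2_eq_square power3_eq_cube mult.assoc)
  have "((\<lambda>u. ln (1 + u) * ln_quotient u - ln 2 * ln_quotient u - ((ln (1 + u))\<^sup>2 - ln 2 * ln (1 + u)) / (1 + u)) has_integral
      zeta3 / 4 - ln 2 * (pi\<^sup>2 / 12) - (- ((ln 2) ^ 3 / 6))) {0..1}"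
    by (intro has_integral_diff has_integral_ln_times_ln_quotient has_integral_mult_right has_integral_ln_quotient q)
  then have p: "(p has_integral zeta3 / 4 - ln 2 * (pi\<^sup>2 / 12) + (ln 2) ^ 3 / 6) {0..1}"
  proof (rule has_integral_eq[rotated, THEN has_integral_eq_rhs])
    fix u :: real assume u: "u \<in> {0..1}"
    have l: "ln (1 + u) = u * ln_quotient u"
      by (simp add: ln_quotient_def)
    show "ln (1 + u) * ln_quotient u - ln 2 * ln_quotient u - ((ln (1 + u))\<^sup>2 - ln 2 * ln (1 + u)) / (1 + u) = p u"
      unfolding p_def l using u by (simp add: divide_simps) (simp add: power2_eq_square algebra_simps)
  qed simp
  have "((\<lambda>y. (- 2 / (1 + y)\<^sup>2) *\<^sub>R p (?g y)) has_integral (integral {?g 0..?g 1} p - integral {?g 1..?g 0} p)) {0..1}"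
  proof (rule has_integral_substitution_general[where s = "{}" and c = 0 and d = 1])
    show "(?g has_real_derivative - 2 / (1 + y)\<^sup>2) (at y within {0..1})" if "y \<in> {0..1} - {}" for y
      using that by (auto intro!: derivative_eq_intros simp: power2_eq_square)
    show "?g ` {0..1} \<subseteq> {0..1}"
      by auto
  qed (auto intro!: cont continuous_intros simp: add_eq_0_iff)
  from has_integral_neg[OF this]
  have "((\<lambda>y. 2 / (1 + y)\<^sup>2 * p (?g y)) has_integral zeta3 / 4 - ln 2 * (pi\<^sup>2 / 12) + (ln 2) ^ 3 / 6) {0..1}"
    using p by (simp add: has_integral_iff)
  then show ?thesis
  proof (rule has_integral_spike_finite[where S = "{1}", rotated 2])
    fix y :: real assume "y \<in> {0..1} - {1}"
    then have y: "0 \<le> y" "y < 1" by auto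
    have e: "1 + ?g y = 2 / (1 + y)"
      using y by (simp add: field_simps)
    have l: "ln (1 + ?g y) = ln 2 - ln (1 + y)"
      unfolding e using y by (simp add: ln_div)
    have "?g y \<noteq> 0"
      using y by simp
    then have "ln_quotient (?g y) = ln (1 + ?g y) / ?g y"
      by (simp only: ln_quotient_def if_False)
    then have p_g: "p (?g y) = (ln 2 - ln (1 + y)) / ?g y * (ln 2 - ln (1 + y) - ln 2) / (2 / (1 + y))"
      by (simp only: p_def l) (simp only: e)
    show "ln (1 + y) * (ln (1 + y) - ln 2) / (1 - y) = 2 / (1 + y)\<^sup>2 * p (?g y)"
      unfolding p_g using y by (simp add: divide_simps) (simp add: power2_eq_square algebra_simps)
  qed simp
qed

definition inner_integral :: "real \<Rightarrow> real" where
  "inner_integral y = integral {0..1} (\<lambda>x. ln (1 + x * y) / (1 + x))"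

lemma inner_integral_has_derivative:
  assumes "y \<in> {0..1}"
  shows "(inner_integral has_real_derivative integral {0..1} (\<lambda>x. x / ((1 + x) * (1 + x * y)))) (at y within {0..1})"
  unfolding inner_integral_def[abs_def] box_real(2)[symmetric]
proof (rule leibniz_rule_field_derivative)
  fix y x :: real assume y: "y \<in> cbox 0 1" and x: "x \<in> cbox 0 1"
  have "0 < 1 + x * y"
    using x y by (intro one_plus_mult_pos) auto
  then show "((\<lambda>y. ln (1 + x * y) / (1 + x)) has_real_derivative x / ((1 + x) * (1 + x * y))) (at y within cbox 0 1)"
    using x by (auto intro!: derivative_eq_intros)
next
  fix y :: real assume y: "y \<in> cbox 0 1"
  have "1 + x * y \<noteq> 0" if "x \<in> {0..1}" for x
    using one_plus_mult_pos[of x y] that y by auto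
  then show "(\<lambda>x. ln (1 + x * y) / (1 + x)) integrable_on cbox 0 1"
    unfolding box_real by (intro integrable_continuous_real continuous_intros) (auto simp: add_eq_0_iff)
next
  have "(1 + fst z) * 1 \<noteq> 0 \<and> 1 + snd z * fst z \<noteq> 0" if "z \<in> cbox 0 1 \<times> cbox 0 1" for z :: "real \<times> real"
    using one_plus_mult_pos[of "snd z" "fst z"] that by auto
  then show "continuous_on (cbox 0 1 \<times> cbox 0 1) (\<lambda>(y, x). x / ((1 + x) * (1 + x * y)) :: real)"
    unfolding case_prod_beta by (intro continuous_intros) (auto simp: add_eq_0_iff)
qed (use assms in auto)

lemma integral_derivative_kernel:
  fixes y :: real
  assumes "0 < y" "y < 1"
  shows "integral {0..1} (\<lambda>x. x / ((1 + x) * (1 + x * y))) = (ln (1 + y) / y - ln 2) / (1 - y)"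
proof -
  let ?F = "\<lambda>x. (ln (1 + x * y) / y - ln (1 + x)) / (1 - y)"
  have "((\<lambda>x. x / ((1 + x) * (1 + x * y))) has_integral ?F 1 - ?F 0) {0..1}"
  proof (rule has_integral_real_FTC)
    fix x :: real assume x: "x \<in> {0..1}"
    have pos: "0 < 1 + x * y"
      using x assms by (intro one_plus_mult_pos) auto
    have "(?F has_real_derivative (1 / (1 + x * y) - 1 / (1 + x)) / (1 - y)) (at x within {0..1})"
      using x pos assms by (auto intro!: derivative_eq_intros)
    also have "(1 / (1 + x * y) - 1 / (1 + x)) / (1 - y) = x / ((1 + x) * (1 + x * y))"
    proof -
      have "1 / (1 + x * y) - 1 / (1 + x) = x * (1 - y) / ((1 + x) * (1 + x * y))"
        using x pos by (simp add: diff_frac_eq algebra_simps)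
      then show ?thesis using assms by simp
    qed
    finally show "(?F has_real_derivative x / ((1 + x) * (1 + x * y))) (at x within {0..1})" .
  qed simp
  then show ?thesis
    by (simp add: has_integral_iff)
qed

lemma inner_integral_1: "inner_integral 1 = (ln 2)\<^sup>2 / 2"
proof -
  have "((\<lambda>x. ln (1 + x * 1) / (1 + x)) has_integral (ln (1 + 1))\<^sup>2 / 2 - (ln (1 + 0))\<^sup>2 / 2) {0..1::real}"
    by (rule has_integral_real_FTC) (auto intro!: derivative_eq_intros simp: field_simps)
  then show ?thesis
    by (simp add: inner_integral_def has_integral_iff)
qed

text \<open>
  Integration by parts: the derivative of \<open>inner_integral y * ln (1 + y)\<close> has two summands, one being
  the integrand and the other, by the closed form of the derivative of \<open>inner_integral\<close> and
  \<open>1 / (y * (1 - y)) = 1 / y + 1 / (1 - y)\<close>, the sum of the two integrands evaluated above.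
\<close>

lemma has_integral_inner_integral:
  "((\<lambda>y. inner_integral y / (1 + y)) has_integral
    pi\<^sup>2 / 12 * ln 2 + 1 / 3 * (ln 2) ^ 3 - 1 / 2 * zeta3) {0..1}"
proof -
  let ?D = "\<lambda>y::real. integral {0..1} (\<lambda>x. x / ((1 + x) * (1 + x * y)))"
  let ?c = "zeta3 / 4 + (zeta3 / 4 - ln 2 * (pi\<^sup>2 / 12) + (ln 2) ^ 3 / 6)"
  have "((\<lambda>y. ln (1 + y) * ln_quotient y + ln (1 + y) * (ln (1 + y) - ln 2) / (1 - y)) has_integral ?c) {0..1}"
    by (intro has_integral_add has_integral_ln_times_ln_quotient has_integral_symmetric_part)
  then have D: "((\<lambda>y. ?D y * ln (1 + y)) has_integral ?c) {0..1}"
  proof (rule has_integral_spike_finite[where S = "{0, 1}", rotated 2])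
    fix y :: real assume "y \<in> {0..1} - {0, 1}"
    then have y: "0 < y" "y < 1" by auto
    show "?D y * ln (1 + y) = ln (1 + y) * ln_quotient y + ln (1 + y) * (ln (1 + y) - ln 2) / (1 - y)"
      unfolding integral_derivative_kernel[OF y] using y
      by (simp add: ln_quotient_def divide_simps) (simp add: algebra_simps)
  qed simp
  have "((\<lambda>y. ?D y * ln (1 + y) + inner_integral y / (1 + y)) has_integral
      inner_integral 1 * ln (1 + 1) - inner_integral 0 * ln (1 + 0)) {0..1}"
    by (rule has_integral_real_FTC)
      (auto intro!: derivative_eq_intros inner_integral_has_derivative)
  from has_integral_diff[OF this D] show ?thesis
    by (rule has_integral_eq_rhs[OF has_integral_eq[rotated]])
      (simp_all add: inner_integral_1 field_simps power2_eq_square power3_eq_cube)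
qed

lemma integral_integrand_x:
  "integral {0..1} (\<lambda>x. ln (1 + x * y) / ((1 + x) * (1 + y))) = inner_integral y / (1 + y)"
  unfolding inner_integral_def by (simp flip: integral_divide divide_divide_eq_left)

theorem mainTheorem2:
  shows "(\<forall>y\<in>{0..1::real}. (\<lambda>x::real. ln (1 + x * y) / ((1 + x) * (1 + y))) integrable_on {0..1})
    \<and> (\<lambda>y::real. integral {0..1} (\<lambda>x::real. ln (1 + x * y) / ((1 + x) * (1 + y)))) integrable_on {0..1}
    \<and> (\<forall>n. summable (\<lambda>k. (-1) ^ k / (real (Suc n) + real (Suc k))))
    \<and> summable (\<lambda>n. (-1) ^ n / real (Suc n) * (\<Sum>k. (-1) ^ k / (real (Suc n) + real (Suc k)))\<^sup>2)
    \<and> integral {0..1} (\<lambda>y::real. integral {0..1} (\<lambda>x::real. ln (1 + x * y) / ((1 + x) * (1 + y))))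
        = (\<Sum>n. (-1) ^ n / real (Suc n) * (\<Sum>k. (-1) ^ k / (real (Suc n) + real (Suc k)))\<^sup>2)
    \<and> (\<Sum>n. (-1) ^ n / real (Suc n) * (\<Sum>k. (-1) ^ k / (real (Suc n) + real (Suc k)))\<^sup>2)
        = pi\<^sup>2 / 12 * ln 2 + 1 / 3 * (ln 2) ^ 3 - 1 / 2 * zeta3"
proof -
  let ?I = "\<lambda>y::real. integral {0..1} (\<lambda>x::real. ln (1 + x * y) / ((1 + x) * (1 + y)))"
  let ?v = "pi\<^sup>2 / 12 * ln 2 + 1 / 3 * (ln 2) ^ 3 - 1 / 2 * zeta3"
  have inner: "\<forall>y\<in>{0..1::real}. (\<lambda>x::real. ln (1 + x * y) / ((1 + x) * (1 + y))) integrable_on {0..1}"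
    by (intro ballI integrable_continuous_real continuous_integrand_x)
  have outer: "(?I has_integral ?v) {0..1}"
    unfolding integral_integrand_x by (rule has_integral_inner_integral)
  have tails: "(\<Sum>k. (-1) ^ k / (real (Suc n) + real (Suc k))) = integral {0..1} (\<lambda>x. x ^ Suc n / (1 + x))" for n
    using alternating_tail_sums_integral[of n] by (rule sums_unique[symmetric])
  have "(\<lambda>n. (-1) ^ n / real (Suc n) * (\<Sum>k. (-1) ^ k / (real (Suc n) + real (Suc k)))\<^sup>2) sums integral {0..1} ?I"
    unfolding tails by (rule double_integral_sums) (use outer in blast)
  then show ?thesis
    using inner outer alternating_tail_sums_integral by (auto simp: sums_iff has_integral_iff)
qed

end
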